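(* Let $R$ be a nonzero left artinian ring with Jacobson radical $J(R)$. Then $R$ is nil-good if and only if $J(R)$ is a maximal (two-sided) ideal of $R$.
   Context: Rings are associative with unity. An element $a$ of a ring $R$ is nil-good if $a = n + u$, where $n \in R$ is nilpotent and $u \in R$ is either $0$ or a unit of $R$. A ring is nil-good if every one of its elements is nil-good. *)

theory Defs
  imports "HOL-Algebra.Ideal"
begin

text \<open>
  The library's \<^locale>\<open>ring\<close> is associative and unital but neither commutative nor
  assumed nonzero; its \<^locale>\<open>ideal\<close> and \<^locale>\<open>maximalideal\<close> are two-sided.
\<close>

locale left_ideal = additive_subgroup I R + ring R for I and R (structure) +
  assumes I_l_closed: "\<lbrakk>a \<in> I; x \<in> carrier R\<rbrakk> \<Longrightarrow> x \<otimes> a \<in> I"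

locale maximal_left_ideal = left_ideal +
  assumes I_notcarr: "carrier R \<noteq> I"
    and I_maximal: "\<lbrakk>left_ideal J R; I \<subseteq> J; J \<subseteq> carrier R\<rbrakk> \<Longrightarrow> (J = I) \<or> (J = carrier R)"

locale left_artinian_ring = ring +
  assumes left_dcc:
    "\<lbrakk>\<And>n::nat. left_ideal (I n) R; \<And>n. I (Suc n) \<subseteq> I n\<rbrakk> \<Longrightarrow> \<exists>N. \<forall>n\<ge>N. I n = I N"

text \<open>
  Intersecting with the carrier makes the radical of the zero ring, which has no maximal left
  ideals, its whole carrier.
\<close>

definition jacobson_radical :: "('a, 'b) ring_scheme \<Rightarrow> 'a set" where
  "jacobson_radical R = carrier R \<inter> \<Inter>{M. maximal_left_ideal M R}"

definition nilpotent :: "('a, 'b) ring_scheme \<Rightarrow> 'a \<Rightarrow> bool" where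
  "nilpotent R a \<longleftrightarrow> a \<in> carrier R \<and> (\<exists>k::nat. a [^]\<^bsub>R\<^esub> k = \<zero>\<^bsub>R\<^esub>)"

definition nil_good :: "('a, 'b) ring_scheme \<Rightarrow> 'a \<Rightarrow> bool" where
  "nil_good R a \<longleftrightarrow> (\<exists>n u. nilpotent R n \<and> (u = \<zero>\<^bsub>R\<^esub> \<or> u \<in> Units R) \<and> a = n \<oplus>\<^bsub>R\<^esub> u)"

definition nil_good_ring :: "('a, 'b) ring_scheme \<Rightarrow> bool" where
  "nil_good_ring R \<longleftrightarrow> ring R \<and> (\<forall>a\<in>carrier R. nil_good R a)"

end

theory Submission
  imports Defs "HOL-Algebra.QuotRing"
begin

text \<open>
  Let \<open>J\<close> be the Jacobson radical of \<open>R\<close>.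

  If \<open>R\<close> is nil-good, every proper two-sided ideal \<open>I\<close> is nil: were \<open>n + u \<in> I\<close> with \<open>n\<close> nilpotent
  and \<open>u\<close> a unit, then modulo \<open>I\<close> the elements \<open>n\<close> and \<open>- u\<close> would agree, and a nilpotent element is no
  unit of the nonzero ring \<open>R / I\<close> (\<open>nil_good_proper_ideal_nil\<close>). A nil left ideal lies in \<open>J\<close>, so \<open>J\<close> is the
  largest proper two-sided ideal (\<open>nil_good_imp_radical_maximal\<close>).

  Conversely, let \<open>J\<close> be maximal. The radical of a left artinian ring is nil, so both units and
  nilpotent elements lift from \<open>R / J\<close> to \<open>R\<close>, and it is enough to write every nonzero element of
  the simple artinian ring \<open>S = R / J\<close> as nilpotent plus unit. Instead of identifying \<open>S\<close> with a
  matrix ring over a division ring, the argument works with idempotents, and simplicity enters only through primeness: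
  \<open>x S y \<noteq> 0\<close> whenever \<open>x\<close> and \<open>y\<close> are nonzero. A minimal left ideal supplies an idempotent \<open>f\<close> whose
  corner \<open>f S f\<close> is a division ring (Brauer), the counterpart of a diagonal matrix unit.

  The decomposition is found by induction on the size of a corner \<open>e S e\<close>. If it is a division ring,
  its nonzero elements are units. Otherwise, for \<open>a \<noteq> 0\<close> in it, choose \<open>f\<close> as
  above inside \<open>e S e\<close> such that, in block form relative to \<open>f\<close> and \<open>h = e - f\<close>,
  the row \<open>f a\<close> and the block \<open>h a h\<close> are both nonzero (\<open>division_idempotent_splitting\<close>). By induction \<open>h a h = n + u\<close>, and
  \<open>block_nil_plus_unit\<close> moves a suitable part \<open>m\<close> of the lower left block \<open>h a f\<close> to the nilpotent side:
  \<open>n + m\<close> is block triangular with nilpotent diagonal, hence nilpotent, and \<open>m\<close> is chosen such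
  that the Schur complement of \<open>u\<close> in \<open>a - (n + m)\<close> is a nonzero element of the division ring \<open>f S f\<close>, which
  makes \<open>a - (n + m)\<close> invertible in \<open>e S e\<close>.
\<close>

section \<open>Left ideals and the Jacobson radical\<close>

context ring
begin

lemma left_idealI:
  assumes "L \<subseteq> carrier R" and "\<zero> \<in> L"
    and "\<And>x y. x \<in> L \<Longrightarrow> y \<in> L \<Longrightarrow> x \<oplus> y \<in> L"
    and "\<And>r x. r \<in> carrier R \<Longrightarrow> x \<in> L \<Longrightarrow> r \<otimes> x \<in> L"
  shows "left_ideal L R"
proof -
  have neg: "\<ominus> x \<in> L" if "x \<in> L" for x
  proof -
    have "\<ominus> x = (\<ominus> \<one>) \<otimes> x" using that assms(1) by (auto simp: l_minus)
    then show ?thesis using that assms(4) by simp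
  qed
  have "subgroup L (add_monoid R)"
    using assms neg by (intro add.subgroupI) auto
  then show ?thesis
    using assms by (intro left_ideal.intro left_ideal_axioms.intro additive_subgroup.intro ring_axioms) auto
qed

lemma principal_left_ideal:
  assumes "x \<in> carrier R"
  shows "left_ideal ((\<lambda>r. r \<otimes> x) ` carrier R) R"
proof (rule left_idealI)
  show "\<zero> \<in> (\<lambda>r. r \<otimes> x) ` carrier R" using assms by (intro image_eqI[of _ _ \<zero>]) auto
next
  fix a b assume "a \<in> (\<lambda>r. r \<otimes> x) ` carrier R" "b \<in> (\<lambda>r. r \<otimes> x) ` carrier R"
  then show "a \<oplus> b \<in> (\<lambda>r. r \<otimes> x) ` carrier R"
    using assms by (force simp: l_distr[symmetric])
next
  fix r a assume "r \<in> carrier R" "a \<in> (\<lambda>r. r \<otimes> x) ` carrier R"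
  then show "r \<otimes> a \<in> (\<lambda>r. r \<otimes> x) ` carrier R"
    using assms by (force simp: m_assoc[symmetric])
qed (use assms in auto)

lemma left_idealD:
  assumes "left_ideal L R"
  shows "L \<subseteq> carrier R" "\<zero> \<in> L" "x \<in> L \<Longrightarrow> y \<in> L \<Longrightarrow> x \<oplus> y \<in> L"
    "r \<in> carrier R \<Longrightarrow> x \<in> L \<Longrightarrow> r \<otimes> x \<in> L" "subgroup L (add_monoid R)"
proof -
  interpret L: left_ideal L R by fact
  show "L \<subseteq> carrier R" "\<zero> \<in> L" "x \<in> L \<Longrightarrow> y \<in> L \<Longrightarrow> x \<oplus> y \<in> L"
    "r \<in> carrier R \<Longrightarrow> x \<in> L \<Longrightarrow> r \<otimes> x \<in> L" "subgroup L (add_monoid R)"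
    using L.a_subset L.I_l_closed L.a_subgroup by auto
qed

lemma left_ideal_eq_carrier:
  assumes "left_ideal L R" "\<one> \<in> L"
  shows "L = carrier R"
  using left_idealD(1)[OF assms(1)] left_idealD(4)[OF assms(1) _ assms(2)] by force

lemma maximal_left_idealD:
  assumes "maximal_left_ideal M R"
  shows "left_ideal M R" "\<one> \<notin> M" "left_ideal K R \<Longrightarrow> M \<subseteq> K \<Longrightarrow> K = M \<or> K = carrier R"
proof -
  interpret M: maximal_left_ideal M R by fact
  show "left_ideal M R" by (rule M.left_ideal_axioms)
  then show "\<one> \<notin> M" using left_ideal_eq_carrier M.I_notcarr by blast
  show "left_ideal K R \<Longrightarrow> M \<subseteq> K \<Longrightarrow> K = M \<or> K = carrier R"
    using M.I_maximal left_idealD(1) by blast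
qed

text \<open>
  Zorn: a union of a chain of left ideals avoiding \<open>\<one>\<close> again avoids \<open>\<one>\<close>.
\<close>
lemma maximal_left_ideal_exists:
  assumes L: "left_ideal L R" "\<one> \<notin> L"
  shows "\<exists>M. maximal_left_ideal M R \<and> L \<subseteq> M"
proof -
  let ?A = "{K. left_ideal K R \<and> \<one> \<notin> K \<and> L \<subseteq> K}"
  have "\<exists>M\<in>?A. \<forall>X\<in>?A. M \<subseteq> X \<longrightarrow> X = M"
  proof (rule subset_Zorn_nonempty)
    show "?A \<noteq> {}" using L by blast
  next
    fix C assume ne: "C \<noteq> {}" and ch: "subset.chain ?A C"
    have C: "K \<in> C \<Longrightarrow> left_ideal K R \<and> \<one> \<notin> K \<and> L \<subseteq> K" for K
      using ch unfolding subset.chain_def by blast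
    have "left_ideal (\<Union>C) R"
    proof (rule left_idealI)
      show "\<Union>C \<subseteq> carrier R" using C left_idealD(1) by blast
      show "\<zero> \<in> \<Union>C" using C ne left_idealD(2) by blast
      show "x \<oplus> y \<in> \<Union>C" if xy: "x \<in> \<Union>C" "y \<in> \<Union>C" for x y
      proof -
        obtain K K' where K: "K \<in> C" "x \<in> K" "K' \<in> C" "y \<in> K'" using xy by blast
        then have "K \<subseteq> K' \<or> K' \<subseteq> K" using ch unfolding subset_chain_def by blast
        then show ?thesis using K C left_idealD(3) by blast
      qed
      show "r \<otimes> x \<in> \<Union>C" if "r \<in> carrier R" "x \<in> \<Union>C" for r x
        using that C left_idealD(4) by blast
    qed
    then show "\<Union>C \<in> ?A" using C ne by blast
  qed
  then obtain M where MA: "M \<in> ?A" and MX: "\<forall>X\<in>?A. M \<subseteq> X \<longrightarrow> X = M" ..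
  then have M: "left_ideal M R" "\<one> \<notin> M" "L \<subseteq> M" by auto
  have max: "X = M" if X: "left_ideal X R" "\<one> \<notin> X" "M \<subseteq> X" for X
  proof -
    have "X \<in> ?A" using X M(3) by auto
    then show ?thesis using MX X(3) by simp
  qed
  have "maximal_left_ideal M R"
  proof (intro maximal_left_ideal.intro maximal_left_ideal_axioms.intro M(1))
    show "carrier R \<noteq> M" using M(2) by blast
    show "J = M \<or> J = carrier R" if J: "left_ideal J R" "M \<subseteq> J" for J
      using max[OF J(1) _ J(2)] left_ideal_eq_carrier[OF J(1)] by (cases "\<one> \<in> J") simp_all
  qed
  then show ?thesis using M by blast
qed

lemma jacobson_radical_left_ideal: "left_ideal (jacobson_radical R) R"
proof (rule left_idealI)
  show "\<zero> \<in> jacobson_radical R"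
    using left_idealD(2)[OF maximal_left_idealD(1)] by (simp add: jacobson_radical_def)
  show "x \<oplus> y \<in> jacobson_radical R" if "x \<in> jacobson_radical R" "y \<in> jacobson_radical R" for x y
    using that left_idealD(3)[OF maximal_left_idealD(1)] by (simp add: jacobson_radical_def)
  show "r \<otimes> x \<in> jacobson_radical R" if "r \<in> carrier R" "x \<in> jacobson_radical R" for r x
    using that left_idealD(4)[OF maximal_left_idealD(1)] by (simp add: jacobson_radical_def)
qed (simp add: jacobson_radical_def)

text \<open>
  Otherwise the left ideal generated by \<open>\<one> \<ominus> x\<close> lies in a maximal one, which also contains \<open>x\<close> and hence \<open>\<one>\<close>.
\<close>
lemma one_minus_radical_left_inverse:
  assumes x: "x \<in> jacobson_radical R"
  shows "\<exists>y\<in>carrier R. y \<otimes> (\<one> \<ominus> x) = \<one>"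
proof (rule ccontr)
  assume no: "\<not> ?thesis"
  have xc: "x \<in> carrier R" using x by (simp add: jacobson_radical_def)
  let ?L = "(\<lambda>r. r \<otimes> (\<one> \<ominus> x)) ` carrier R"
  have "left_ideal ?L R" "\<one> \<notin> ?L" using no xc by (auto intro!: principal_left_ideal)
  then obtain M where M: "maximal_left_ideal M R" "?L \<subseteq> M" using maximal_left_ideal_exists by blast
  have "x \<in> M" using x M by (auto simp: jacobson_radical_def)
  moreover have "\<one> \<ominus> x \<in> M" using M(2) xc by (auto intro!: subsetD[OF M(2)] image_eqI[of _ _ \<one>])
  ultimately have "(\<one> \<ominus> x) \<oplus> x \<in> M" using left_idealD(3)[OF maximal_left_idealD(1)[OF M(1)]] by blast
  moreover have "(\<one> \<ominus> x) \<oplus> x = \<one>" using xc by algebra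
  ultimately show False using maximal_left_idealD(2)[OF M(1)] by simp
qed

lemma two_sided_inverse_unit:
  assumes "x \<in> carrier R" "y \<in> carrier R" "z \<in> carrier R" "y \<otimes> x = \<one>" "x \<otimes> z = \<one>"
  shows "x \<in> Units R"
proof -
  have "y = y \<otimes> (x \<otimes> z)" using assms by simp
  also have "\<dots> = (y \<otimes> x) \<otimes> z" using assms(1-3) by (simp only: m_assoc)
  also have "\<dots> = z" using assms by simp
  finally show ?thesis using assms unfolding Units_def by blast
qed

text \<open>
  A left inverse \<open>y\<close> of \<open>\<one> \<ominus> x\<close> satisfies \<open>y = \<one> \<ominus> (\<ominus> y) \<otimes> x\<close>, so it is itself of the form covered by
  the previous lemma. Having a left and a right inverse, \<open>y\<close> is a unit.
\<close>
lemma one_minus_radical_unit: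
  assumes x: "x \<in> jacobson_radical R"
  shows "\<one> \<ominus> x \<in> Units R"
proof -
  have xc: "x \<in> carrier R" using x by (simp add: jacobson_radical_def)
  obtain y where y: "y \<in> carrier R" "y \<otimes> (\<one> \<ominus> x) = \<one>" using one_minus_radical_left_inverse[OF x] by blast
  have "\<one> \<ominus> (\<ominus> y) \<otimes> x = \<one> \<oplus> y \<otimes> x" using y xc by (simp add: ring_simprules)
  also have "\<dots> = y \<otimes> (\<one> \<ominus> x) \<oplus> y \<otimes> x" using y by simp
  also have "\<dots> = y" using y(1) xc by (simp add: ring_simprules)
  finally have "\<one> \<ominus> (\<ominus> y) \<otimes> x = y" .
  moreover have "(\<ominus> y) \<otimes> x \<in> jacobson_radical R"
    using left_idealD(4)[OF jacobson_radical_left_ideal _ x] y by simp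
  ultimately obtain z where z: "z \<in> carrier R" "z \<otimes> y = \<one>"
    using one_minus_radical_left_inverse by metis
  have "z = z \<otimes> (y \<otimes> (\<one> \<ominus> x))" using y z by simp
  also have "\<dots> = (z \<otimes> y) \<otimes> (\<one> \<ominus> x)" using y(1) z(1) xc by (simp only: m_assoc minus_closed one_closed)
  also have "\<dots> = \<one> \<ominus> x" using z xc by simp
  finally show ?thesis using y z xc unfolding Units_def by auto
qed

text \<open>
  If \<open>L\<close> is not contained in a maximal left ideal \<open>M\<close>, then \<open>\<one> = m \<oplus> l\<close> with \<open>m \<in> M\<close> and
  \<open>l \<in> L\<close>, and the left inverse of \<open>m = \<one> \<ominus> l\<close> puts \<open>\<one>\<close> into \<open>M\<close>.
\<close>
lemma left_ideal_subset_jacobson_radical: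
  assumes L: "left_ideal L R" and inv: "\<And>x. x \<in> L \<Longrightarrow> \<exists>y\<in>carrier R. y \<otimes> (\<one> \<ominus> x) = \<one>"
  shows "L \<subseteq> jacobson_radical R"
proof -
  note Ld = left_idealD[OF L]
  have "x \<in> M" if M: "maximal_left_ideal M R" and x: "x \<in> L" for M x
  proof (rule ccontr)
    assume xM: "x \<notin> M"
    note Md = left_idealD[OF maximal_left_idealD(1)[OF M]]
    let ?K = "{m \<oplus> l | m l. m \<in> M \<and> l \<in> L}"
    have "left_ideal ?K R"
    proof (rule left_idealI)
      show "?K \<subseteq> carrier R" using Ld(1) Md(1) by blast
      show "\<zero> \<in> ?K" using Ld(2) Md(2) by force
      show "p \<oplus> q \<in> ?K" if pq: "p \<in> ?K" "q \<in> ?K" for p q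
      proof -
        obtain m l m' l' where ml: "m \<in> M" "l \<in> L" "m' \<in> M" "l' \<in> L" "p = m \<oplus> l" "q = m' \<oplus> l'"
          using pq by blast
        then have "p \<oplus> q = (m \<oplus> m') \<oplus> (l \<oplus> l')"
          using subsetD[OF Ld(1)] subsetD[OF Md(1)] by (simp add: a_ac)
        then show ?thesis using ml Ld(3) Md(3) by blast
      qed
      show "r \<otimes> p \<in> ?K" if rp: "r \<in> carrier R" "p \<in> ?K" for r p
      proof -
        obtain m l where ml: "m \<in> M" "l \<in> L" "p = m \<oplus> l" using rp by blast
        then have "r \<otimes> p = r \<otimes> m \<oplus> r \<otimes> l"
          using subsetD[OF Ld(1)] subsetD[OF Md(1)] rp by (simp add: r_distr)
        then show ?thesis using ml rp Ld(4) Md(4) by blast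
      qed
    qed
    moreover have "M \<subseteq> ?K"
    proof
      fix m assume "m \<in> M"
      moreover from this have "m = m \<oplus> \<zero>" using Md(1) by auto
      ultimately show "m \<in> ?K" using Ld(2) by blast
    qed
    moreover have "?K \<noteq> M"
    proof -
      have "x = \<zero> \<oplus> x" using x Ld(1) by auto
      then have "x \<in> ?K" using x Md(2) by blast
      then show ?thesis using xM by blast
    qed
    ultimately have "?K = carrier R" using maximal_left_idealD(3)[OF M] by blast
    then have "\<one> \<in> ?K" by simp
    then obtain m l where ml: "m \<in> M" "l \<in> L" "\<one> = m \<oplus> l" by blast
    have c: "m \<in> carrier R" "l \<in> carrier R" using ml Md(1) Ld(1) by auto
    have "\<one> \<ominus> l = m" unfolding ml(3) using c by algebra
    then obtain y where "y \<in> carrier R" "y \<otimes> m = \<one>" using inv[OF ml(2)] by auto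
    then have "\<one> \<in> M" using Md(4) ml(1) by metis
    then show False using maximal_left_idealD(2)[OF M] by blast
  qed
  then show ?thesis using Ld(1) by (auto simp: jacobson_radical_def)
qed

text \<open>
  Closure under right multiplication rests on the fact that \<open>\<one> \<ominus> b \<otimes> x\<close> is left invertible as soon
  as \<open>\<one> \<ominus> x \<otimes> b\<close> is.
\<close>
lemma jacobson_radical_ideal: "ideal (jacobson_radical R) R"
proof (rule idealI[OF ring_axioms])
  show "subgroup (jacobson_radical R) (add_monoid R)" by (rule left_idealD(5)[OF jacobson_radical_left_ideal])
next
  fix a x assume a: "a \<in> jacobson_radical R" and x: "x \<in> carrier R"
  show "x \<otimes> a \<in> jacobson_radical R" by (rule left_idealD(4)[OF jacobson_radical_left_ideal x a])
  have ac: "a \<in> carrier R" using a by (simp add: jacobson_radical_def)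
  let ?L = "(\<lambda>r. r \<otimes> (a \<otimes> x)) ` carrier R"
  have "?L \<subseteq> jacobson_radical R"
  proof (rule left_ideal_subset_jacobson_radical)
    show "left_ideal ?L R" using principal_left_ideal ac x by simp
    fix z assume "z \<in> ?L"
    then obtain r where r: "r \<in> carrier R" "z = r \<otimes> (a \<otimes> x)" by blast
    define b where "b = r \<otimes> a"
    have b: "b \<in> carrier R" "z = b \<otimes> x" using r ac x by (simp_all add: b_def m_assoc)
    have "x \<otimes> b \<in> jacobson_radical R"
      unfolding b_def using r x a left_idealD(4)[OF jacobson_radical_left_ideal] by auto
    then obtain y where y: "y \<in> carrier R" "y \<otimes> (\<one> \<ominus> x \<otimes> b) = \<one>"
      using one_minus_radical_left_inverse by blast
    have "(\<one> \<oplus> b \<otimes> y \<otimes> x) \<otimes> (\<one> \<ominus> b \<otimes> x) = (\<one> \<ominus> b \<otimes> x) \<oplus> b \<otimes> (y \<otimes> (\<one> \<ominus> x \<otimes> b)) \<otimes> x"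
      using b(1) x y(1) by (simp add: a_minus_def l_distr r_distr l_minus r_minus m_assoc minus_add a_ac)
    also have "\<dots> = \<one>" using b(1) x y by (simp add: a_minus_def a_assoc l_neg)
    finally show "\<exists>y\<in>carrier R. y \<otimes> (\<one> \<ominus> z) = \<one>"
      using b x y by (intro bexI[of _ "\<one> \<oplus> b \<otimes> y \<otimes> x"]) auto
  qed
  moreover have "a \<otimes> x \<in> ?L" using ac x by (intro image_eqI[of _ _ \<one>]) auto
  ultimately show "a \<otimes> x \<in> jacobson_radical R" by blast
qed

text \<open>
  Modulo the left ideal generated by \<open>\<one> \<ominus> x\<close> all powers of \<open>x\<close> are congruent to \<open>\<one>\<close>, and one of them
  vanishes.
\<close>
lemma one_minus_nilpotent_left_inverse:
  assumes "nilpotent R x"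
  shows "\<exists>y\<in>carrier R. y \<otimes> (\<one> \<ominus> x) = \<one>"
proof -
  obtain k where xc: "x \<in> carrier R" and k: "x [^] (k::nat) = \<zero>" using assms unfolding nilpotent_def by blast
  let ?L = "(\<lambda>r. r \<otimes> (\<one> \<ominus> x)) ` carrier R"
  have L: "left_ideal ?L R" using xc by (simp add: principal_left_ideal)
  have "\<one> \<ominus> x [^] i \<in> ?L" for i :: nat
  proof (induction i)
    case 0
    then show ?case using left_idealD(2)[OF L] by (simp add: a_minus_def r_neg)
  next
    case (Suc i)
    have "\<one> \<ominus> x [^] Suc i = (\<one> \<ominus> x [^] i) \<oplus> x [^] i \<otimes> (\<one> \<ominus> x)"
    proof -
      have "\<one> \<ominus> p \<otimes> x = (\<one> \<ominus> p) \<oplus> p \<otimes> (\<one> \<ominus> x)" if "p \<in> carrier R" for p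
      proof -
        have "p \<otimes> (\<one> \<ominus> x) = p \<ominus> p \<otimes> x" using that xc by (simp add: a_minus_def r_distr r_minus)
        then show ?thesis using that xc one_closed by algebra
      qed
      then show ?thesis using xc by simp
    qed
    moreover have "x [^] i \<otimes> (\<one> \<ominus> x) \<in> ?L" using xc by blast
    ultimately show ?case using left_idealD(3)[OF L Suc] by simp
  qed
  from this[of k] have "\<one> \<in> ?L" using k by (simp add: a_minus_def)
  then obtain y where "\<one> = y \<otimes> (\<one> \<ominus> x)" "y \<in> carrier R" by (rule imageE)
  then show ?thesis by metis
qed

section \<open>The radical of a nil-good ring\<close>

text \<open>
  If \<open>x = n \<oplus> u\<close> with a unit \<open>u\<close>, then \<open>n [^] (k + 1) \<in> I\<close> implies \<open>n [^] k \<otimes> u \<in> I\<close> and so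
  \<open>n [^] k \<in> I\<close>. Descending from \<open>\<zero> = n [^] k \<in> I\<close> reaches \<open>\<one> \<in> I\<close>.
\<close>
lemma nil_good_proper_ideal_nil:
  assumes I: "ideal I R" "I \<noteq> carrier R" and x: "x \<in> I" "nil_good R x"
  shows "nilpotent R x"
proof -
  interpret I: ideal I R by fact
  obtain n u where n: "nilpotent R n" and u: "u = \<zero> \<or> u \<in> Units R" and xnu: "x = n \<oplus> u"
    using x(2) unfolding nil_good_def by blast
  have nc: "n \<in> carrier R" using n unfolding nilpotent_def by blast
  have xc: "x \<in> carrier R" using x I.a_subset by auto
  have "u \<notin> Units R"
  proof
    assume un: "u \<in> Units R"
    then have uc: "u \<in> carrier R" "inv u \<in> carrier R" by auto
    have "n [^] k \<notin> I" for k :: nat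
    proof (induction k)
      case 0
      then show ?case using I I.one_imp_carrier by auto
    next
      case (Suc k)
      show ?case
      proof
        assume 1: "n [^] Suc k \<in> I"
        have "n [^] k \<otimes> x \<in> I" using x nc I.I_l_closed by simp
        then have "n [^] k \<otimes> x \<ominus> n [^] Suc k \<in> I" using 1 I.a_closed I.a_inv_closed by (simp add: a_minus_def)
        moreover have "n [^] k \<otimes> x \<ominus> n [^] Suc k = n [^] k \<otimes> u"
        proof -
          have "p \<otimes> (n \<oplus> u) \<ominus> p \<otimes> n = p \<otimes> u" if "p \<in> carrier R" for p
            using that nc uc by algebra
          then show ?thesis using nc xnu by simp
        qed
        ultimately have "n [^] k \<otimes> u \<otimes> inv u \<in> I" using I.I_r_closed uc by simp
        then have "n [^] k \<in> I" using un uc nc by (simp add: m_assoc)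
        then show False using Suc by blast
      qed
    qed
    moreover obtain k where "n [^] (k::nat) = \<zero>" using n unfolding nilpotent_def by blast
    ultimately show False using I.zero_closed by metis
  qed
  then show ?thesis using u n nc xnu by simp
qed

lemma nil_good_imp_radical_maximal:
  assumes "nil_good_ring R" "\<one> \<noteq> \<zero>"
  shows "maximalideal (jacobson_radical R) R"
proof (rule maximalidealI[OF jacobson_radical_ideal])
  show "carrier R \<noteq> jacobson_radical R"
  proof
    assume "carrier R = jacobson_radical R"
    then have "\<one> \<ominus> \<one> \<in> Units R" using one_minus_radical_unit one_closed by blast
    then show False using assms(2) unfolding Units_def by (auto simp: a_minus_def r_neg)
  qed
  fix I assume I: "ideal I R" "jacobson_radical R \<subseteq> I" "I \<subseteq> carrier R"
  show "I = jacobson_radical R \<or> I = carrier R"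
  proof (rule disjCI)
    assume ne: "I \<noteq> carrier R"
    have "I \<subseteq> jacobson_radical R"
    proof (rule left_ideal_subset_jacobson_radical)
      interpret I: ideal I R by fact
      show "left_ideal I R" using I.a_subset I.I_l_closed I.zero_closed I.a_closed by (intro left_idealI) auto
      show "\<exists>y\<in>carrier R. y \<otimes> (\<one> \<ominus> x) = \<one>" if "x \<in> I" for x
        using that nil_good_proper_ideal_nil[OF I(1) ne that] one_minus_nilpotent_left_inverse assms(1) I(3)
        unfolding nil_good_ring_def by auto
    qed
    then show "I = jacobson_radical R" using I(2) by blast
  qed
qed

end

section \<open>Corners and division idempotents\<close>

text \<open>
  The Peirce corner \<open>eRe\<close> of an idempotent \<open>e\<close>, whose unity is \<open>e\<close>. It is a subset of \<open>R\<close> and not a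
  ring record, since the induction below passes through many corners of one ring.
\<close>
definition corner :: "('a, 'b) ring_scheme \<Rightarrow> 'a \<Rightarrow> 'a set" where
  "corner R e = {x \<in> carrier R. e \<otimes>\<^bsub>R\<^esub> x = x \<and> x \<otimes>\<^bsub>R\<^esub> e = x}"

definition division_idempotent :: "('a, 'b) ring_scheme \<Rightarrow> 'a \<Rightarrow> bool" where
  "division_idempotent R f \<longleftrightarrow> f \<in> corner R f \<and> f \<noteq> \<zero>\<^bsub>R\<^esub> \<and>
     (\<forall>x\<in>corner R f - {\<zero>\<^bsub>R\<^esub>}. \<exists>y\<in>corner R f. x \<otimes>\<^bsub>R\<^esub> y = f \<and> y \<otimes>\<^bsub>R\<^esub> x = f)"

text \<open>
  The unit is a unit of the corner at \<open>e\<close>, with inverse \<open>v\<close>; the summand zero that nil-good elements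
  may have in place of a unit is excluded.
\<close>
definition nil_plus_unit :: "('a, 'b) ring_scheme \<Rightarrow> 'a \<Rightarrow> 'a \<Rightarrow> bool" where
  "nil_plus_unit R e a \<longleftrightarrow> (\<exists>n\<in>corner R e. \<exists>u\<in>corner R e. \<exists>v\<in>corner R e.
     nilpotent R n \<and> u \<otimes>\<^bsub>R\<^esub> v = e \<and> v \<otimes>\<^bsub>R\<^esub> u = e \<and> a = n \<oplus>\<^bsub>R\<^esub> u)"

context ring
begin

text \<open>
  Lets the simplifier apply an equation \<open>x \<otimes> y = z\<close> inside products associated to the right.
\<close>
lemma mult_eq_assoc:
  "x \<otimes> y = z \<Longrightarrow> x \<in> carrier R \<Longrightarrow> y \<in> carrier R \<Longrightarrow> a \<in> carrier R \<Longrightarrow> x \<otimes> (y \<otimes> a) = z \<otimes> a"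
  by (metis m_assoc)

text \<open>
  Peirce blocks multiply like matrix blocks: the column index of \<open>x\<close> must meet the row index of \<open>y\<close>.
\<close>
lemma mult_zero_across:
  assumes "x \<in> carrier R" "y \<in> carrier R" "f \<in> carrier R" "h \<in> carrier R"
    and "x \<otimes> f = x" "h \<otimes> y = y" "f \<otimes> h = \<zero>"
  shows "x \<otimes> y = \<zero>"
proof -
  have "x \<otimes> y = (x \<otimes> f) \<otimes> (h \<otimes> y)" using assms by simp
  also have "\<dots> = x \<otimes> ((f \<otimes> h) \<otimes> y)" using assms(1-4) by algebra
  finally show ?thesis using assms by simp
qed

lemma cornerD: 
  assumes "x \<in> corner R e" shows "x \<in> carrier R" "e \<otimes> x = x" "x \<otimes> e = x"
  using assms by (auto simp: corner_def)

lemma corner_mem: "e \<in> corner R e \<Longrightarrow> x \<in> carrier R \<Longrightarrow> e \<otimes> x \<otimes> e \<in> corner R e"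
  by (auto simp: corner_def m_assoc) (metis m_assoc m_closed)

lemma corner_mono:
  assumes "f \<in> corner R e" "e \<in> carrier R" "x \<in> corner R f"
  shows "x \<in> corner R e"
  using assms unfolding corner_def by (auto) (metis m_assoc)+

lemma corner_diff:
  assumes e: "e \<in> corner R e" and f: "f \<in> corner R e" "f \<in> corner R f"
  shows "e \<ominus> f \<in> corner R e" "e \<ominus> f \<in> corner R (e \<ominus> f)" "f \<otimes> (e \<ominus> f) = \<zero>" "(e \<ominus> f) \<otimes> f = \<zero>"
    "f \<oplus> (e \<ominus> f) = e"
  using cornerD[OF e] cornerD[OF f(1)] cornerD[OF f(2)] unfolding corner_def
  by (auto simp: ring_simprules)

lemma square_zero_unit:
  assumes "e \<in> carrier R" "x \<in> carrier R" "e \<otimes> e = e" "e \<otimes> x = x" "x \<otimes> e = x" "x \<otimes> x = \<zero>"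
  shows "(e \<oplus> x) \<otimes> (e \<ominus> x) = e" "(e \<ominus> x) \<otimes> (e \<oplus> x) = e"
  using assms by (auto simp: ring_simprules)

text \<open>
  For a lower triangular block matrix \<open>n \<oplus> m\<close> every product starting with \<open>m\<close> vanishes, so that
  \<open>(n \<oplus> m) [^] (j + 1) = n [^] j \<otimes> (n \<oplus> m)\<close>.
\<close>
lemma triangular_nilpotent:
  assumes n: "nilpotent R n" and m: "m \<in> carrier R" and "m \<otimes> m = \<zero>" "m \<otimes> n = \<zero>"
  shows "nilpotent R (n \<oplus> m)"
proof -
  obtain k where k: "n [^] (k::nat) = \<zero>" and nc: "n \<in> carrier R"
    using n unfolding nilpotent_def by blast
  have "(n \<oplus> m) [^] Suc j = n [^] j \<otimes> (n \<oplus> m)" for j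
  proof (induction j)
    case 0 then show ?case using nc m by simp
  next
    case (Suc j)
    have "(n \<oplus> m) \<otimes> (n \<oplus> m) = n \<otimes> (n \<oplus> m)"
      using nc assms by (simp add: l_distr r_distr)
    then show ?case using Suc nc m by (simp add: m_assoc)
  qed
  from this[of k] k show ?thesis
    using nc m unfolding nilpotent_def by (auto intro!: exI[of _ "Suc k"] simp del: nat_pow_Suc)
qed

text \<open>
  Write \<open>a\<close> as a block matrix with rows \<open>(faf, b)\<close> and \<open>(c, n \<oplus> u)\<close>. The nilpotent part is the block
  matrix with rows \<open>(0, 0)\<close> and \<open>(c \<ominus> u \<otimes> d, n)\<close>. What remains has rows \<open>(faf, b)\<close> and
  \<open>(u \<otimes> d, u)\<close>; the Schur complement of \<open>u\<close> in it is \<open>w = faf \<ominus> b \<otimes> d\<close>, and it is invertible because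
  it factors as upper unitriangular times \<open>diag(w, u)\<close> times lower unitriangular.
\<close>
lemma block_nil_plus_unit:
  assumes f: "f \<in> corner R f" and h: "h \<in> corner R h" and fh: "f \<otimes> h = \<zero>" "h \<otimes> f = \<zero>"
    and a: "a \<in> corner R (f \<oplus> h)"
    and nil: "n \<in> corner R h" "nilpotent R n"
    and uv: "u \<in> corner R h" "v \<in> corner R h" "u \<otimes> v = h" "v \<otimes> u = h"
    and d: "d \<in> carrier R" "h \<otimes> d = d" "d \<otimes> f = d"
    and w: "w \<in> corner R f" "w' \<in> corner R f" "w \<otimes> w' = f" "w' \<otimes> w = f"
    and lower: "h \<otimes> a \<otimes> h = n \<oplus> u"
    and upper: "f \<otimes> a \<otimes> f = w \<oplus> (f \<otimes> a \<otimes> h) \<otimes> d"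
  shows "nil_plus_unit R (f \<oplus> h) a"
proof -
  define e where "e = f \<oplus> h"
  define b where "b = f \<otimes> a \<otimes> h"
  define c where "c = h \<otimes> a \<otimes> f"
  note F = cornerD[OF f] and H = cornerD[OF h]
  note [simp] = F(1) H(1) d(1) cornerD(1)[OF nil(1)] cornerD(1)[OF uv(1)] cornerD(1)[OF uv(2)]
    cornerD(1)[OF w(1)] cornerD(1)[OF w(2)] cornerD(1)[OF a]
  have ec [simp]: "e \<in> carrier R" by (simp add: e_def)
  have b: "b \<in> carrier R" "f \<otimes> b = b" "b \<otimes> h = b"
    unfolding b_def using F H by (auto simp: m_assoc mult_eq_assoc[OF F(2)])
  have c: "c \<in> carrier R" "h \<otimes> c = c" "c \<otimes> f = c"
    unfolding c_def using F H by (auto simp: m_assoc mult_eq_assoc[OF H(2)])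
  note [simp] = b(1) c(1)
  have ee: "e \<otimes> e = e" unfolding e_def using F H fh by (simp add: ring_simprules)
  have left: "e \<otimes> x = x" if "x \<in> carrier R" "f \<otimes> x = x \<or> h \<otimes> x = x" for x
    using that(2)
  proof
    assume "f \<otimes> x = x"
    then show ?thesis using that(1) mult_zero_across[of h x h f] fh H F by (simp add: e_def l_distr)
  next
    assume "h \<otimes> x = x"
    then show ?thesis using that(1) mult_zero_across[of f x f h] fh H F by (simp add: e_def l_distr)
  qed
  have right: "x \<otimes> e = x" if "x \<in> carrier R" "x \<otimes> f = x \<or> x \<otimes> h = x" for x
    using that(2)
  proof
    assume "x \<otimes> f = x"
    then show ?thesis using that(1) mult_zero_across[of x h f h] fh H F by (simp add: e_def r_distr)
  next
    assume "x \<otimes> h = x"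
    then show ?thesis using that(1) mult_zero_across[of x f h f] fh H F by (simp add: e_def r_distr)
  qed
  define x where "x = b \<otimes> v"
  have x: "x \<in> carrier R" "f \<otimes> x = x" "x \<otimes> h = x"
    unfolding x_def using b cornerD[OF uv(2)] by (auto simp: m_assoc mult_eq_assoc[OF b(2)])
  note [simp] = x(1)
  have xx: "x \<otimes> x = \<zero>" using mult_zero_across[OF _ _ _ _ x(3) x(2) fh(2)] by simp
  have dd: "d \<otimes> d = \<zero>" using mult_zero_across[OF _ _ _ _ d(3) d(2) fh(1)] by simp
  define y where "y = w \<oplus> u"
  define y' where "y' = w' \<oplus> v"
  have [simp]: "y \<in> carrier R" "y' \<in> carrier R" by (auto simp: y_def y'_def)
  note zero = mult_zero_across[of _ _ f h, OF _ _ F(1) H(1) _ _ fh(1)]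
    mult_zero_across[of _ _ h f, OF _ _ H(1) F(1) _ _ fh(2)]
  note W = cornerD[OF w(1)] and W' = cornerD[OF w(2)] and U = cornerD[OF uv(1)] and V = cornerD[OF uv(2)]
  have "w \<otimes> v = \<zero>" "u \<otimes> w' = \<zero>" "w' \<otimes> u = \<zero>" "v \<otimes> w = \<zero>"
    using W W' U V by (simp_all add: zero(1)[of w v] zero(2)[of u w'] zero(1)[of w' u] zero(2)[of v w])
  then have yy': "y \<otimes> y' = e" "y' \<otimes> y = e"
    unfolding y_def y'_def e_def using w(3,4) uv(3,4) by (simp_all add: l_distr r_distr)
  have ey: "e \<otimes> y = y" "y \<otimes> e = y" "e \<otimes> y' = y'" "y' \<otimes> e = y'"
    unfolding y_def y'_def using W W' U V left right by (simp_all add: l_distr r_distr)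
  \<comment> \<open>The unitriangular factors have inverses with the opposite sign, as \<open>x\<close> and \<open>d\<close> square to zero.\<close>
  define U0 where "U0 = (e \<oplus> x) \<otimes> y \<otimes> (e \<oplus> d)"
  define V0 where "V0 = (e \<ominus> d) \<otimes> y' \<otimes> (e \<ominus> x)"
  have sx': "(e \<oplus> x) \<otimes> (e \<ominus> x) = e" "(e \<ominus> x) \<otimes> (e \<oplus> x) = e" using square_zero_unit[OF ec x(1) ee _ _ xx] left right x by auto
  have sd': "(e \<oplus> d) \<otimes> (e \<ominus> d) = e" "(e \<ominus> d) \<otimes> (e \<oplus> d) = e" using square_zero_unit[OF ec d(1) ee _ _ dd] left right d by auto
  have "U0 \<otimes> V0 = (e \<oplus> x) \<otimes> (y \<otimes> (((e \<oplus> d) \<otimes> (e \<ominus> d)) \<otimes> y')) \<otimes> (e \<ominus> x)"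
    unfolding U0_def V0_def by (simp add: m_assoc)
  also have "\<dots> = (e \<oplus> x) \<otimes> e \<otimes> (e \<ominus> x)" using sd' ey yy' by simp
  also have "\<dots> = e" using sx' left right x ee by (simp add: l_distr)
  finally have UV: "U0 \<otimes> V0 = e" .
  have "V0 \<otimes> U0 = (e \<ominus> d) \<otimes> (y' \<otimes> (((e \<ominus> x) \<otimes> (e \<oplus> x)) \<otimes> y)) \<otimes> (e \<oplus> d)"
    unfolding U0_def V0_def by (simp add: m_assoc)
  also have "\<dots> = (e \<ominus> d) \<otimes> (e \<otimes> (e \<oplus> d))" using sx' ey yy' by (simp add: m_assoc)
  also have "\<dots> = e" using sd' left right d ee by (simp add: r_distr)
  finally have VU: "V0 \<otimes> U0 = e" .
  have ex: "e \<otimes> x = x" "x \<otimes> e = x" "e \<otimes> d = d" "d \<otimes> e = d" using left right x d by auto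
  have Uc: "U0 \<in> corner R e" "V0 \<in> corner R e"
    unfolding U0_def V0_def corner_def using ee ex
    by (auto simp: m_assoc[symmetric] l_distr r_distr a_minus_def l_minus r_minus)
     (simp_all add: m_assoc l_distr r_distr a_minus_def l_minus r_minus)
  have "x \<otimes> w = \<zero>" "w \<otimes> d = \<zero>" using x d W by (simp_all add: zero(2)[of x w] zero(1)[of w d])
  moreover have "x \<otimes> u = b" unfolding x_def using uv(4) b by (simp add: m_assoc)
  ultimately have U0: "U0 = w \<oplus> b \<oplus> u \<oplus> (b \<otimes> d \<oplus> u \<otimes> d)"
  proof -
    assume A: "x \<otimes> w = \<zero>" "w \<otimes> d = \<zero>" "x \<otimes> u = b"
    have "(e \<oplus> x) \<otimes> y = w \<oplus> u \<oplus> b"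
      unfolding y_def using A left W U by (simp add: l_distr r_distr a_ac)
    then have "U0 = (w \<oplus> u \<oplus> b) \<otimes> (e \<oplus> d)" by (simp add: U0_def)
    also have "\<dots> = (w \<oplus> u \<oplus> b) \<oplus> (u \<otimes> d \<oplus> b \<otimes> d)"
      using A right W U b by (simp add: l_distr r_distr a_ac)
    finally show ?thesis by (simp add: a_ac)
  qed
  define N where "N = n \<oplus> (c \<ominus> u \<otimes> d)"
  have m: "h \<otimes> (c \<ominus> u \<otimes> d) = c \<ominus> u \<otimes> d" "(c \<ominus> u \<otimes> d) \<otimes> f = c \<ominus> u \<otimes> d"
    using c U d by (simp_all add: a_minus_def l_distr r_distr l_minus r_minus m_assoc mult_eq_assoc[OF U(2)])
  have nN: "nilpotent R N" unfolding N_def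
    
  proof (rule triangular_nilpotent[OF nil(2)])
    show "(c \<ominus> u \<otimes> d) \<otimes> (c \<ominus> u \<otimes> d) = \<zero>" by (rule zero(1)) (use m in simp_all)
    show "(c \<ominus> u \<otimes> d) \<otimes> n = \<zero>" by (rule zero(1)) (use m cornerD[OF nil(1)] in simp_all)
  qed simp
  have Nc: "N \<in> corner R e"
    unfolding N_def corner_def using m left right cornerD[OF nil(1)] by (simp add: l_distr r_distr)
  have "a = e \<otimes> a \<otimes> e" using cornerD[OF a] by (simp add: e_def)
  also have "\<dots> = f \<otimes> a \<otimes> f \<oplus> f \<otimes> a \<otimes> h \<oplus> h \<otimes> a \<otimes> f \<oplus> h \<otimes> a \<otimes> h"
    unfolding e_def by (simp add: ring_simprules)
  also have "\<dots> = (w \<oplus> b \<otimes> d) \<oplus> b \<oplus> c \<oplus> (n \<oplus> u)"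
    using lower upper by (simp add: b_def c_def)
  also have "\<dots> = N \<oplus> U0"
  proof -
    have "n \<oplus> (c \<ominus> t) \<oplus> (w \<oplus> b \<oplus> u \<oplus> (s \<oplus> t)) = (w \<oplus> s) \<oplus> b \<oplus> c \<oplus> (n \<oplus> u)"
      if "s \<in> carrier R" "t \<in> carrier R" for s t
      using that b(1) c(1) cornerD(1)[OF nil(1)] cornerD(1)[OF uv(1)] cornerD(1)[OF w(1)] by algebra
    then show ?thesis unfolding N_def U0 by simp
  qed
  finally show ?thesis
    unfolding nil_plus_unit_def e_def[symmetric] using Uc Nc nN UV VU by blast
qed

text \<open>
  If \<open>q \<otimes> p = f\<close>, then \<open>z \<mapsto> q \<otimes> z \<otimes> p\<close> is an isomorphism from the corner of \<open>p \<otimes> q\<close> onto the corner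
  of \<open>f\<close>, with inverse \<open>x \<mapsto> p \<otimes> x \<otimes> q\<close>. This is the source of all further division idempotents once
  one is known.
\<close>
lemma division_idempotent_transport:
  assumes f: "division_idempotent R f" and pq: "p \<in> carrier R" "q \<in> carrier R"
    and qp: "q \<otimes> p = f" "p \<otimes> f = p" "f \<otimes> q = q"
  shows "division_idempotent R (p \<otimes> q)"
proof -
  have F: "f \<in> carrier R" "f \<otimes> f = f" "f \<noteq> \<zero>" 
    and inv: "\<And>x. x \<in> corner R f \<Longrightarrow> x \<noteq> \<zero> \<Longrightarrow> \<exists>y\<in>corner R f. x \<otimes> y = f \<and> y \<otimes> x = f"
    using f unfolding division_idempotent_def by (auto dest: cornerD)
  note E = mult_eq_assoc[OF qp(1)] mult_eq_assoc[OF qp(2)] mult_eq_assoc[OF qp(3)]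
  have idem: "p \<otimes> q \<in> corner R (p \<otimes> q)"
    using pq F by (simp add: corner_def m_assoc E qp)
  have ne: "p \<otimes> q \<noteq> \<zero>"
  proof
    assume "p \<otimes> q = \<zero>"
    then have "q \<otimes> (p \<otimes> q) \<otimes> p = \<zero>" using pq by simp
    then show False using pq F by (simp add: m_assoc E qp)
  qed
  have "\<exists>y\<in>corner R (p \<otimes> q). z \<otimes> y = p \<otimes> q \<and> y \<otimes> z = p \<otimes> q"
    if z: "z \<in> corner R (p \<otimes> q)" "z \<noteq> \<zero>" for z
  proof -
    note Z = cornerD[OF z(1)]
    have zz: "p \<otimes> (q \<otimes> z) = z" "z \<otimes> (p \<otimes> q) = z" using Z pq by (simp_all add: m_assoc)
    define x where "x = q \<otimes> z \<otimes> p"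
    have xc: "x \<in> corner R f" unfolding x_def corner_def using pq F Z qp E by (simp add: m_assoc)
    have zx: "z = p \<otimes> x \<otimes> q" unfolding x_def using pq F Z zz by (simp add: m_assoc)
    then have "x \<noteq> \<zero>" using z pq by auto
    then obtain y where y: "y \<in> corner R f" "x \<otimes> y = f" "y \<otimes> x = f" using inv xc by blast
    note X = cornerD[OF xc] and Y = cornerD[OF y(1)]
    have "p \<otimes> y \<otimes> q \<in> corner R (p \<otimes> q)"
      unfolding corner_def using pq F Y qp E by (simp add: m_assoc mult_eq_assoc[OF Y(2)] mult_eq_assoc[OF Y(3)])
    moreover have "z \<otimes> (p \<otimes> y \<otimes> q) = p \<otimes> q" "p \<otimes> y \<otimes> q \<otimes> z = p \<otimes> q"
      unfolding zx using pq F X Y qp E y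
      by (simp_all add: m_assoc mult_eq_assoc[OF Y(2)] mult_eq_assoc[OF X(2)]
          mult_eq_assoc[OF y(2)] mult_eq_assoc[OF y(3)])
    ultimately show ?thesis by blast
  qed
  then show ?thesis unfolding division_idempotent_def using idem ne by blast
qed

lemma eq_if_minus_zero:
  assumes "x \<in> carrier R" "y \<in> carrier R" "x \<ominus> y = \<zero>"
  shows "x = y"
proof -
  have "x = (x \<ominus> y) \<oplus> y" using assms(1,2) by algebra
  then show ?thesis using assms by simp
qed

lemma minus_nonzero:
  assumes "x \<in> carrier R" "x \<noteq> \<zero>"
  shows "\<ominus> x \<noteq> \<zero>"
  using assms by (metis minus_minus minus_zero)

end

section \<open>Nonzero elements of prime left artinian rings\<close>

lemma (in left_artinian_ring) wf_left_ideals: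
  "wf {(K, L). left_ideal K R \<and> left_ideal L R \<and> K \<subset> L}"
proof -
  have False if "\<forall>i::nat. (I (Suc i), I i) \<in> {(K, L). left_ideal K R \<and> left_ideal L R \<and> K \<subset> L}" for I
  proof -
    have I: "left_ideal (I i) R" "I (Suc i) \<subset> I i" for i using that by auto
    obtain N where "\<forall>n\<ge>N. I n = I N" using left_dcc[of I] I by blast
    then have "I (Suc N) = I N" using le_SucI[OF order_refl] by blast
    then show False using I(2)[of N] by blast
  qed
  then show ?thesis unfolding wf_iff_no_infinite_down_chain by blast
qed

locale prime_left_artinian_ring = left_artinian_ring +
  assumes prime: "\<lbrakk>x \<in> carrier R; y \<in> carrier R; x \<noteq> \<zero>; y \<noteq> \<zero>\<rbrakk> \<Longrightarrow> \<exists>s\<in>carrier R. x \<otimes> s \<otimes> y \<noteq> \<zero>"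
begin

text \<open>
  Brauer: for a minimal left ideal \<open>L\<close>, primeness yields \<open>b \<in> L\<close> with \<open>L \<otimes> b\<close> nonzero, hence equal to \<open>L\<close>
  by minimality. So \<open>c \<otimes> b = b\<close> for some \<open>c \<in> L\<close>, and \<open>c\<close> is idempotent because right multiplication by \<open>b\<close>
  has zero kernel on \<open>L\<close>. Each nonzero \<open>z\<close> in the corner of \<open>c\<close> generates \<open>L\<close>, which gives left inverses.
\<close>
lemma division_idempotent_exists:
  assumes "\<one> \<noteq> \<zero>"
  shows "\<exists>f. division_idempotent R f"
proof -
  let ?Q = "{L. left_ideal L R \<and> (\<exists>x\<in>L. x \<noteq> \<zero>)}"
  have "carrier R \<in> ?Q" using assms by (auto intro!: left_idealI)
  then obtain L where "L \<in> ?Q" and "\<And>K. (K, L) \<in> {(K, L). left_ideal K R \<and> left_ideal L R \<and> K \<subset> L} \<Longrightarrow> K \<notin> ?Q"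
    by (rule wfE_min[OF wf_left_ideals]) blast
  then have L: "left_ideal L R" and ne: "\<exists>x\<in>L. x \<noteq> \<zero>"
    and min: "\<And>K x. left_ideal K R \<Longrightarrow> K \<subseteq> L \<Longrightarrow> x \<in> K \<Longrightarrow> x \<noteq> \<zero> \<Longrightarrow> K = L"
    by auto
  interpret L: left_ideal L R by (rule L)
  have Lc: "\<And>x. x \<in> L \<Longrightarrow> x \<in> carrier R" using L.a_subset by auto
  obtain x where x: "x \<in> L" "x \<noteq> \<zero>" using ne by blast
  obtain s where s: "s \<in> carrier R" "x \<otimes> s \<otimes> x \<noteq> \<zero>" using prime[OF Lc Lc] x by blast
  define b where "b = s \<otimes> x"
  have b: "b \<in> L" using s x L.I_l_closed by (simp add: b_def)
  have xb: "x \<otimes> b \<noteq> \<zero>" using s x Lc by (simp add: b_def m_assoc)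
  have "(\<lambda>y. y \<otimes> b) ` L = L"
  proof (rule min)
    show "left_ideal ((\<lambda>y. y \<otimes> b) ` L) R"
    proof (rule left_idealI)
      show "\<zero> \<in> (\<lambda>y. y \<otimes> b) ` L" using L.zero_closed Lc[OF b] by (intro image_eqI[of _ _ \<zero>]) auto
    next
      fix p q assume "p \<in> (\<lambda>y. y \<otimes> b) ` L" "q \<in> (\<lambda>y. y \<otimes> b) ` L"
      then show "p \<oplus> q \<in> (\<lambda>y. y \<otimes> b) ` L"
        using Lc b L.a_closed by (force simp: l_distr[symmetric])
    next
      fix r p assume "r \<in> carrier R" "p \<in> (\<lambda>y. y \<otimes> b) ` L"
      then show "r \<otimes> p \<in> (\<lambda>y. y \<otimes> b) ` L"
        using Lc b L.I_l_closed by (force simp: m_assoc[symmetric])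
    qed (use Lc b in auto)
    show "(\<lambda>y. y \<otimes> b) ` L \<subseteq> L" using Lc b L.I_l_closed by auto
    show "x \<otimes> b \<in> (\<lambda>y. y \<otimes> b) ` L" using x by blast
  qed (rule xb)
  then obtain c where c: "c \<in> L" "c \<otimes> b = b" using b by (metis imageE)
  have bc: "b \<in> carrier R" "c \<in> carrier R" using b c Lc by auto
  have cc: "c \<otimes> c = c"
  proof (rule ccontr)
    assume ne: "c \<otimes> c \<noteq> c"
    have "{y \<in> L. y \<otimes> b = \<zero>} = L"
    proof (rule min)
      show "left_ideal {y \<in> L. y \<otimes> b = \<zero>} R"
        using Lc bc L.zero_closed L.a_closed L.I_l_closed by (intro left_idealI) (auto simp: l_distr m_assoc)
      show "c \<otimes> c \<ominus> c \<in> {y \<in> L. y \<otimes> b = \<zero>}"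
      proof -
        have "c \<otimes> c \<ominus> c = (c \<ominus> \<one>) \<otimes> c" using bc by (simp add: ring_simprules)
        then have "c \<otimes> c \<ominus> c \<in> L" using c bc L.I_l_closed by simp
        moreover have "(c \<otimes> c \<ominus> c) \<otimes> b = \<zero>" using bc c(2) by (simp add: ring_simprules)
        ultimately show ?thesis by simp
      qed
      show "c \<otimes> c \<ominus> c \<noteq> \<zero>" using ne bc eq_if_minus_zero[of "c \<otimes> c" c] by auto
    qed auto
    then show False using x xb by blast
  qed
  have c0: "c \<noteq> \<zero>" using c bc xb x Lc by auto
  have left_inv: "\<exists>y\<in>corner R c. y \<noteq> \<zero> \<and> y \<otimes> z = c" if z: "z \<in> corner R c" "z \<noteq> \<zero>" for z
  proof -
    note Z = cornerD[OF z(1)]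
    have "(\<lambda>r. r \<otimes> z) ` carrier R = L"
    proof (rule min[OF principal_left_ideal])
      have "z \<in> L" using L.I_l_closed[OF c(1) Z(1)] Z by simp
      then show "(\<lambda>r. r \<otimes> z) ` carrier R \<subseteq> L" using L.I_l_closed by auto
      show "z \<in> (\<lambda>r. r \<otimes> z) ` carrier R" using Z by (intro image_eqI[of _ _ \<one>]) auto
    qed (use Z z in auto)
    then obtain r where r: "r \<in> carrier R" "r \<otimes> z = c" using c(1) by (metis imageE)
    have "c \<otimes> r \<otimes> c \<otimes> z = c" using r Z cc bc by (simp add: m_assoc)
    moreover from this have "c \<otimes> r \<otimes> c \<noteq> \<zero>" using c0 Z by auto
    ultimately show ?thesis using corner_mem[of c r] r(1) cc bc(2) by (intro bexI[of _ "c \<otimes> r \<otimes> c"]) (auto simp: corner_def)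
  qed
  have "\<exists>y\<in>corner R c. z \<otimes> y = c \<and> y \<otimes> z = c" if z: "z \<in> corner R c" "z \<noteq> \<zero>" for z
  proof -
    obtain y where y: "y \<in> corner R c" "y \<noteq> \<zero>" "y \<otimes> z = c" using left_inv[OF z] by blast
    obtain w where w: "w \<in> corner R c" "w \<otimes> y = c" using left_inv[OF y(1,2)] by blast
    have "w = w \<otimes> (y \<otimes> z)" using y(3) cornerD[OF w(1)] by simp
    also have "\<dots> = z" using w(2) cornerD[OF w(1)] cornerD[OF y(1)] cornerD[OF z(1)]
      by (simp add: m_assoc[symmetric])
    finally show ?thesis using w y by blast
  qed
  then have "division_idempotent R c"
    unfolding division_idempotent_def using c0 cc bc by (auto simp: corner_def)
  then show ?thesis ..
qed

text \<open>
  For any division idempotent \<open>f\<close>, primeness gives \<open>x = f \<otimes> s \<otimes> e\<close> with \<open>x \<otimes> a \<noteq> \<zero>\<close> and then \<open>p\<close> in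
  \<open>e \<otimes> R \<otimes> f\<close> with \<open>x \<otimes> p = f\<close>. The transported idempotent \<open>p \<otimes> x\<close> lies in the corner of \<open>e\<close>, and
  \<open>x \<otimes> (p \<otimes> x) = x\<close> shows that it does not annihilate \<open>a\<close>.
\<close>
lemma division_idempotent_detecting:
  assumes e: "e \<in> corner R e" and a: "a \<in> carrier R" "e \<otimes> a \<noteq> \<zero>"
  shows "\<exists>f\<in>corner R e. division_idempotent R f \<and> f \<otimes> a \<noteq> \<zero>"
proof -
  note E = cornerD[OF e]
  have "\<one> \<noteq> \<zero>" using a E by (metis r_null l_one l_null)
  then obtain f where f: "division_idempotent R f" using division_idempotent_exists by blast
  have F: "f \<in> carrier R" "f \<otimes> f = f" "f \<noteq> \<zero>" 
    and inv: "\<And>x. x \<in> corner R f \<Longrightarrow> x \<noteq> \<zero> \<Longrightarrow> \<exists>y\<in>corner R f. x \<otimes> y = f \<and> y \<otimes> x = f"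
    using f unfolding division_idempotent_def by (auto dest: cornerD)
  obtain s where s: "s \<in> carrier R" "f \<otimes> s \<otimes> (e \<otimes> a) \<noteq> \<zero>"
    using prime[OF F(1) _ F(3), of "e \<otimes> a"] a E by auto
  define x where "x = f \<otimes> s \<otimes> e"
  have x: "x \<in> carrier R" "f \<otimes> x = x" "x \<otimes> e = x" "x \<otimes> a \<noteq> \<zero>"
    unfolding x_def using s F E a by (auto simp: m_assoc mult_eq_assoc[OF F(2)])
  then have "x \<noteq> \<zero>" using a by auto
  then obtain r where r: "r \<in> carrier R" "x \<otimes> r \<otimes> f \<noteq> \<zero>" using prime[OF x(1) F(1) _ F(3)] by auto
  have "x \<otimes> r \<otimes> f \<in> corner R f" using x r F by (simp add: corner_def m_assoc mult_eq_assoc[OF x(2)])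
  then obtain y where y: "y \<in> corner R f" "x \<otimes> r \<otimes> f \<otimes> y = f" using inv r by blast
  note Y = cornerD[OF y(1)]
  define p where "p = e \<otimes> r \<otimes> y"
  have p: "p \<in> carrier R" "e \<otimes> p = p" "p \<otimes> f = p"
    unfolding p_def using E r Y F by (auto simp: m_assoc mult_eq_assoc[OF E(2)])
  have xp: "x \<otimes> p = f"
    unfolding p_def using y(2) E r Y F x by (simp add: m_assoc mult_eq_assoc[OF x(3)])
  have "division_idempotent R (p \<otimes> x)" by (rule division_idempotent_transport[OF f p(1) x(1) xp p(3) x(2)])
  moreover have "p \<otimes> x \<in> corner R e"
    using p x E by (simp add: corner_def m_assoc mult_eq_assoc[OF p(2)])
  moreover have "p \<otimes> x \<otimes> a \<noteq> \<zero>"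
  proof
    assume 0: "p \<otimes> x \<otimes> a = \<zero>"
    have "x \<otimes> (p \<otimes> x \<otimes> a) = x \<otimes> a"
      using p x a by (simp add: m_assoc[symmetric] xp)
    then show False using 0 x by simp
  qed
  ultimately show ?thesis by blast
qed

text \<open>
  When \<open>f \<otimes> b = b\<close>, the complement of \<open>f\<close> kills \<open>b\<close>. Tilting \<open>f\<close> to \<open>f \<oplus> t\<close> with \<open>t\<close> in
  \<open>(e \<ominus> f) \<otimes> R \<otimes> f\<close> repairs this, as the new complement sends \<open>b\<close> to \<open>\<ominus> (t \<otimes> b)\<close>. The relation
  \<open>f \<otimes> f' = f\<close> ensures that \<open>f' \<otimes> y \<noteq> \<zero>\<close> whenever \<open>f \<otimes> y \<noteq> \<zero>\<close>.
\<close>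
lemma complement_detecting:
  assumes e: "e \<in> corner R e" and f: "division_idempotent R f" "f \<in> corner R e" "f \<noteq> e"
    and b: "b \<in> carrier R" "e \<otimes> b = b" "b \<noteq> \<zero>"
  shows "\<exists>f'\<in>corner R e. division_idempotent R f' \<and> f \<otimes> f' = f \<and> f' \<otimes> f = f' \<and> (e \<ominus> f') \<otimes> b \<noteq> \<zero>"
proof (cases "(e \<ominus> f) \<otimes> b = \<zero>")
  case False
  moreover have "f \<otimes> f = f" using f unfolding division_idempotent_def by (auto dest: cornerD)
  ultimately show ?thesis using f by blast
next
  case True
  have ff: "f \<in> corner R f" using f unfolding division_idempotent_def by blast
  note E = cornerD[OF e] and F = cornerD[OF f(2)] cornerD(2)[OF ff]
  define h where "h = e \<ominus> f"
  have h: "h \<in> carrier R" "e \<otimes> h = h" "f \<otimes> h = \<zero>" "h \<otimes> f = \<zero>" "h \<otimes> h = h"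
    using corner_diff[OF e f(2) ff] by (auto simp: h_def dest: cornerD)
  have "h \<noteq> \<zero>" using f(3) eq_if_minus_zero[OF E(1) F(1)] by (auto simp: h_def)
  then obtain s where s: "s \<in> carrier R" "h \<otimes> s \<otimes> b \<noteq> \<zero>" using prime[OF h(1) b(1)] b by blast
  have "(e \<ominus> f) \<otimes> b = b \<ominus> f \<otimes> b" using E F b by (simp add: a_minus_def l_distr l_minus)
  then have "f \<otimes> b = b" using True eq_if_minus_zero[of b "f \<otimes> b"] F b by simp
  define t where "t = h \<otimes> s \<otimes> f"
  have t: "t \<in> carrier R" "h \<otimes> t = t" "t \<otimes> f = t" "t \<otimes> b \<noteq> \<zero>" "e \<otimes> t = t" "t \<otimes> e = t"
    unfolding t_def using h s F E \<open>f \<otimes> b = b\<close> b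
    by (auto simp: m_assoc mult_eq_assoc[OF h(2)] mult_eq_assoc[OF h(5)])
  have ft: "f \<otimes> t = \<zero>" using h t F E by (metis m_assoc l_null)
  define f' where "f' = f \<oplus> t"
  have f': "f' \<in> carrier R" "f \<otimes> f' = f" "f' \<otimes> f = f'" 
    unfolding f'_def using t F ft by (auto simp: l_distr r_distr)
  have "division_idempotent R (f' \<otimes> f)"
    by (rule division_idempotent_transport[OF f(1)]) (use f' F in auto)
  moreover have "f' \<in> corner R e" 
    unfolding f'_def corner_def using t F E by (auto simp: l_distr r_distr)
  moreover have "(e \<ominus> f') \<otimes> b \<noteq> \<zero>"
  proof -
    have "(e \<ominus> f') \<otimes> b = \<ominus> (t \<otimes> b)"
      unfolding f'_def using E F t b \<open>f \<otimes> b = b\<close> by (simp add: ring_simprules)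
    then show ?thesis using minus_nonzero[OF _ t(4)] t b by simp
  qed
  ultimately show ?thesis using f' by auto
qed

text \<open>
  Start from some \<open>f\<close> with \<open>f \<otimes> a \<noteq> \<zero>\<close>. If \<open>a \<otimes> (e \<ominus> f) \<noteq> \<zero>\<close>, a tilt of \<open>f\<close> detecting this element works. Otherwise
  \<open>a = a \<otimes> f\<close> has rank one, and every tilt \<open>f \<oplus> t\<close> with \<open>t\<close> in \<open>(e \<ominus> f) \<otimes> R \<otimes> f\<close> still
  satisfies \<open>a \<otimes> (e \<ominus> (f \<oplus> t)) = \<zero>\<close>. After a tilt to \<open>f'\<close> with
  \<open>(e \<ominus> f') \<otimes> a \<noteq> \<zero>\<close>, a division idempotent \<open>g\<close> orthogonal to \<open>f'\<close> with \<open>g \<otimes> a \<noteq> \<zero>\<close> does the job: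
  the block of \<open>a\<close> at \<open>e \<ominus> g\<close> still contains \<open>f' \<otimes> a \<otimes> f' = f' \<otimes> a\<close>.
\<close>
lemma division_idempotent_splitting:
  assumes e: "e \<in> corner R e" "\<not> division_idempotent R e" and a: "a \<in> corner R e" "a \<noteq> \<zero>"
  shows "\<exists>f\<in>corner R e. division_idempotent R f \<and> f \<otimes> a \<noteq> \<zero> \<and> (e \<ominus> f) \<otimes> a \<otimes> (e \<ominus> f) \<noteq> \<zero>"
proof -
  note E = cornerD[OF e(1)] and A = cornerD[OF a(1)]
  obtain f where f: "f \<in> corner R e" "division_idempotent R f" "f \<otimes> a \<noteq> \<zero>"
    using division_idempotent_detecting[OF e(1) A(1)] A a by auto
  then have fe: "f \<noteq> e" using e by auto
  have ff: "f \<in> corner R f" using f unfolding division_idempotent_def by blast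
  note F = cornerD[OF f(1)] cornerD(2)[OF ff]
  show ?thesis
  proof (cases "a \<otimes> (e \<ominus> f) = \<zero>")
    case False
    then obtain f' where f': "f' \<in> corner R e" "division_idempotent R f'" "f \<otimes> f' = f" "f' \<otimes> f = f'"
      "(e \<ominus> f') \<otimes> (a \<otimes> (e \<ominus> f)) \<noteq> \<zero>"
      using complement_detecting[OF e(1) f(2,1) fe, of "a \<otimes> (e \<ominus> f)"] A E F
      by (auto simp: m_assoc[symmetric])
    note F' = cornerD[OF f'(1)]
    have "(e \<ominus> f') \<otimes> (e \<ominus> f) = e \<ominus> f"
      using E F F' f'(4) by (simp add: ring_simprules)
    then have "(e \<ominus> f') \<otimes> a \<otimes> (e \<ominus> f') \<otimes> (e \<ominus> f) \<noteq> \<zero>"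
      using f'(5) A E F F' by (simp add: m_assoc)
    then have "(e \<ominus> f') \<otimes> a \<otimes> (e \<ominus> f') \<noteq> \<zero>" using E F by auto
    moreover have "f' \<otimes> a \<noteq> \<zero>"
    proof
      assume "f' \<otimes> a = \<zero>"
      then have "f \<otimes> (f' \<otimes> a) = \<zero>" using F by simp
      then show False using f(3) F F' A f'(3) by (simp add: m_assoc[symmetric])
    qed
    ultimately show ?thesis using f' by blast
  next
    case True
    moreover have "a \<otimes> (e \<ominus> f) = a \<ominus> a \<otimes> f" using A E F by (simp add: a_minus_def r_distr r_minus)
    ultimately have af: "a \<otimes> f = a" using eq_if_minus_zero[of a "a \<otimes> f"] A F by simp
    obtain f' where f': "f' \<in> corner R e" "division_idempotent R f'" "f \<otimes> f' = f" "f' \<otimes> f = f'"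
      "(e \<ominus> f') \<otimes> a \<noteq> \<zero>"
      using complement_detecting[OF e(1) f(2,1) fe A(1,2) a(2)] by auto
    have ff': "f' \<in> corner R f'" using f' unfolding division_idempotent_def by blast
    note F' = cornerD[OF f'(1)]
    note D = corner_diff[OF e(1) f'(1) ff']
    obtain g where g: "g \<in> corner R (e \<ominus> f')" "division_idempotent R g" "g \<otimes> a \<noteq> \<zero>"
      using division_idempotent_detecting[OF D(2) A(1) f'(5)] by auto
    note G = cornerD[OF g(1)]
    have ge: "g \<in> corner R e" using corner_mono[OF D(1) E(1) g(1)] .
    have "f' \<otimes> g = \<zero>" "g \<otimes> f' = \<zero>"
      using D(3,4) G F' E by (metis m_assoc l_null minus_closed, metis m_assoc r_null minus_closed)
    then have fg: "f' \<otimes> (e \<ominus> g) = f'" "(e \<ominus> g) \<otimes> f' = f'"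
      using E F' G by (simp_all add: ring_simprules)
    have af': "a \<otimes> f' = a" using af f'(3) A F F' by (metis m_assoc)
    have "(e \<ominus> g) \<otimes> a \<otimes> (e \<ominus> g) \<noteq> \<zero>"
    proof
      assume 0: "(e \<ominus> g) \<otimes> a \<otimes> (e \<ominus> g) = \<zero>"
      have "f' \<otimes> a = (f' \<otimes> (e \<ominus> g)) \<otimes> a \<otimes> ((e \<ominus> g) \<otimes> f')"
        using fg af' F' A by (simp add: m_assoc)
      also have "\<dots> = f' \<otimes> ((e \<ominus> g) \<otimes> a \<otimes> (e \<ominus> g)) \<otimes> f'"
        using E F' G A by (simp add: m_assoc)
      finally have "f' \<otimes> a = \<zero>" using 0 F' by simp
      then have "f \<otimes> (f' \<otimes> a) = \<zero>" using F by simp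
      then show False using f(3) F F' A f'(3) by (simp add: m_assoc[symmetric])
    qed
    then show ?thesis using g ge by blast
  qed
qed

text \<open>
  Well-founded induction on the left ideal generated by \<open>e\<close>, which shrinks strictly from \<open>e\<close> to \<open>e \<ominus> f\<close>.
\<close>
lemma corner_nil_plus_unit:
  assumes "e \<in> corner R e" "a \<in> corner R e" "a \<noteq> \<zero>"
  shows "nil_plus_unit R e a"
  using wf_inv_image[OF wf_left_ideals, of "\<lambda>e. (\<lambda>r. r \<otimes> e) ` carrier R"] assms
proof (induction e arbitrary: a rule: wf_induct_rule)
  case (less e)
  note e = less.prems(1) and a = less.prems(2,3)
  note E = cornerD[OF e] and A = cornerD[OF a(1)]
  show ?case
  proof (cases "division_idempotent R e")
    case True
    then obtain b where "b \<in> corner R e" "a \<otimes> b = e" "b \<otimes> a = e"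
      using a unfolding division_idempotent_def by blast
    moreover have "nilpotent R \<zero>" unfolding nilpotent_def by (auto intro!: exI[of _ "1::nat"])
    moreover have "\<zero> \<in> corner R e" "a = \<zero> \<oplus> a" using E A by (auto simp: corner_def)
    ultimately show ?thesis unfolding nil_plus_unit_def using a by blast
  next
    case False
    obtain f where f: "f \<in> corner R e" "division_idempotent R f" "f \<otimes> a \<noteq> \<zero>"
       "(e \<ominus> f) \<otimes> a \<otimes> (e \<ominus> f) \<noteq> \<zero>"
      using division_idempotent_splitting[OF e False a] by blast
    have ff: "f \<in> corner R f" "f \<noteq> \<zero>"
      and inv: "\<And>x. x \<in> corner R f \<Longrightarrow> x \<noteq> \<zero> \<Longrightarrow> \<exists>y\<in>corner R f. x \<otimes> y = f \<and> y \<otimes> x = f"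
      using f(2) unfolding division_idempotent_def by auto
    note F = cornerD[OF f(1)] cornerD(2)[OF ff(1)]
    define h where "h = e \<ominus> f"
    have h: "h \<in> corner R e" "h \<in> corner R h" "f \<otimes> h = \<zero>" "h \<otimes> f = \<zero>" "f \<oplus> h = e"
      using corner_diff[OF e f(1) ff(1)] by (auto simp: h_def)
    note H = cornerD[OF h(1)] cornerD(2)[OF h(2)]
    have "(\<lambda>r. r \<otimes> h) ` carrier R \<subset> (\<lambda>r. r \<otimes> e) ` carrier R"
    proof
      show "(\<lambda>r. r \<otimes> h) ` carrier R \<subseteq> (\<lambda>r. r \<otimes> e) ` carrier R"
      proof clarify
        fix r assume "r \<in> carrier R"
        then show "r \<otimes> h \<in> (\<lambda>r. r \<otimes> e) ` carrier R"
          using H E by (intro image_eqI[of _ _ "r \<otimes> h"]) (auto simp: m_assoc)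
      qed
      show "(\<lambda>r. r \<otimes> h) ` carrier R \<noteq> (\<lambda>r. r \<otimes> e) ` carrier R"
      proof
        assume eq: "(\<lambda>r. r \<otimes> h) ` carrier R = (\<lambda>r. r \<otimes> e) ` carrier R"
        have "f \<in> (\<lambda>r. r \<otimes> e) ` carrier R" using F by (intro image_eqI[of _ _ f]) auto
        then obtain r where r: "r \<in> carrier R" "f = r \<otimes> h" using eq by blast
        then have "f \<otimes> f = r \<otimes> (h \<otimes> f)" using F H by (metis m_assoc)
        then show False using h r ff F by simp
      qed
    qed
    then have "nil_plus_unit R h (h \<otimes> a \<otimes> h)"
      using less.IH[of h "h \<otimes> a \<otimes> h"] h(2) f(4) corner_mem[OF h(2) A(1)]
        principal_left_ideal H(1) E(1) by (simp add: h_def)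
    then obtain n u v where nuv: "n \<in> corner R h" "nilpotent R n" "u \<in> corner R h" "v \<in> corner R h" 
      "u \<otimes> v = h" "v \<otimes> u = h" "h \<otimes> a \<otimes> h = n \<oplus> u" unfolding nil_plus_unit_def by blast
    define b where "b = f \<otimes> a \<otimes> h"
    have b: "b \<in> carrier R" "f \<otimes> b = b" "b \<otimes> h = b"
      unfolding b_def using F H A by (auto simp: m_assoc mult_eq_assoc[OF F(4)])
    have faf: "f \<otimes> a \<otimes> f \<in> corner R f" using corner_mem[OF ff(1) A(1)] .
    \<comment> \<open>If \<open>f \<otimes> a \<otimes> f = \<zero>\<close>, then \<open>b \<noteq> \<zero>\<close> as the row \<open>f \<otimes> a\<close> is nonzero, and primeness provides \<open>d\<close>.\<close>
    have "\<exists>d\<in>carrier R. h \<otimes> d = d \<and> d \<otimes> f = d \<and> f \<otimes> a \<otimes> f \<ominus> b \<otimes> d \<noteq> \<zero>"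
    proof (cases "f \<otimes> a \<otimes> f = \<zero>")
      case False
      then show ?thesis using F H A b by (intro bexI[of _ \<zero>]) (auto simp: a_minus_def)
    next
      case True
      have "f \<otimes> a = f \<otimes> a \<otimes> f \<oplus> b" unfolding b_def
        using h(5) A F H by (metis m_assoc m_closed r_distr)
      then have "b \<noteq> \<zero>" using True f(3) b by auto
      then obtain s where s: "s \<in> carrier R" "b \<otimes> s \<otimes> f \<noteq> \<zero>" using prime[OF b(1) F(1) _ ff(2)] by blast
      have "b \<otimes> (h \<otimes> s \<otimes> f) = b \<otimes> s \<otimes> f" using b s H F by (simp add: m_assoc[symmetric])
      then have "f \<otimes> a \<otimes> f \<ominus> b \<otimes> (h \<otimes> s \<otimes> f) \<noteq> \<zero>" 
        using True s b F H minus_nonzero[of "b \<otimes> s \<otimes> f"] by (simp add: a_minus_def)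
      then show ?thesis using s F H 
        by (intro bexI[of _ "h \<otimes> s \<otimes> f"]) (auto simp: m_assoc mult_eq_assoc[OF H(4)])
    qed
    then obtain d where d: "d \<in> carrier R" "h \<otimes> d = d" "d \<otimes> f = d" "f \<otimes> a \<otimes> f \<ominus> b \<otimes> d \<noteq> \<zero>" by blast
    \<comment> \<open>The Schur complement of \<open>u\<close>, invertible because it is a nonzero element of a division ring.\<close>
    define w where "w = f \<otimes> a \<otimes> f \<ominus> b \<otimes> d"
    have "b \<otimes> d \<in> corner R f" using b d F by (auto simp: corner_def m_assoc mult_eq_assoc[OF b(2)])
    then have wc: "w \<in> corner R f" unfolding w_def using faf F
      by (auto simp: corner_def a_minus_def l_distr r_distr l_minus r_minus)
    then obtain w' where w': "w' \<in> corner R f" "w \<otimes> w' = f" "w' \<otimes> w = f" using inv d(4) w_def by blast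
    have "f \<otimes> a \<otimes> f = w \<oplus> (f \<otimes> a \<otimes> h) \<otimes> d"
      unfolding w_def b_def[symmetric] using cornerD(1)[OF faf] b d by (simp add: a_minus_def a_assoc l_neg)
    then have "nil_plus_unit R (f \<oplus> h) a"
      using block_nil_plus_unit[OF ff(1) h(2,3,4) _ nuv(1-6) d(1-3) wc w' nuv(7)] a h(5) by simp
    then show ?thesis using h(5) by simp
  qed
qed

end

section \<open>Lifting decompositions modulo the radical\<close>

text \<open>
  The elements \<open>z\<close> with \<open>z \<otimes> R \<otimes> y \<subseteq> M\<close> form a two-sided ideal above \<open>M\<close>; if it contained \<open>x\<close>, it would be
  everything and contain \<open>\<one>\<close>.
\<close>
lemma (in ring) maximal_ideal_prime:
  assumes M: "maximalideal M R" and xy: "x \<in> carrier R" "y \<in> carrier R" "x \<notin> M" "y \<notin> M"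
  shows "\<exists>s\<in>carrier R. x \<otimes> s \<otimes> y \<notin> M"
proof (rule ccontr)
  assume "\<not> ?thesis"
  then have all: "\<forall>s\<in>carrier R. x \<otimes> s \<otimes> y \<in> M" by simp
  interpret M: maximalideal M R by fact
  let ?I = "{z \<in> carrier R. \<forall>s\<in>carrier R. z \<otimes> s \<otimes> y \<in> M}"
  have "left_ideal ?I R"
    using xy(2) M.zero_closed M.a_closed M.I_l_closed by (intro left_idealI) (auto simp: l_distr m_assoc)
  note I = left_idealD[OF this]
  have "ideal ?I R"
  proof (rule idealI[OF ring_axioms I(5)])
    fix z r assume z: "z \<in> ?I" and r: "r \<in> carrier R"
    show "r \<otimes> z \<in> ?I" by (rule I(4)[OF r z])
    have "z \<otimes> r \<otimes> s \<otimes> y \<in> M" if s: "s \<in> carrier R" for s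
    proof -
      have "z \<otimes> (r \<otimes> s) \<otimes> y \<in> M" using z r s by blast
      then show ?thesis using z r s by (simp add: m_assoc)
    qed
    then show "z \<otimes> r \<in> ?I" using z r by simp
  qed
  moreover have "M \<subseteq> ?I" using M.a_subset M.I_r_closed xy(2) by auto
  ultimately have "?I = M \<or> ?I = carrier R" using M.I_maximal by blast
  moreover have "x \<in> ?I" using all xy by simp
  ultimately have "?I = carrier R" using xy(3) by auto
  then have "\<one> \<in> ?I" by simp
  then have "\<one> \<otimes> \<one> \<otimes> y \<in> M" by simp
  then show False using xy by simp
qed

text \<open>
  The left ideals generated by the powers of \<open>a\<close> become stationary, so \<open>a [^] N = r \<otimes> a \<otimes> a [^] N\<close> for some
  \<open>N\<close> and \<open>r\<close>. Since \<open>\<one> \<ominus> r \<otimes> a\<close> is left invertible, \<open>a [^] N = \<zero>\<close>.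
\<close>
lemma (in left_artinian_ring) jacobson_radical_nil:
  assumes a: "a \<in> jacobson_radical R"
  shows "nilpotent R a"
proof -
  have ac: "a \<in> carrier R" using a by (simp add: jacobson_radical_def)
  define I where "I k = (\<lambda>r. r \<otimes> a [^] k) ` carrier R" for k :: nat
  have "left_ideal (I k) R" for k unfolding I_def using ac by (simp add: principal_left_ideal)
  moreover have "I (Suc k) \<subseteq> I k" for k
  proof
    fix z assume "z \<in> I (Suc k)"
    then obtain r where r: "r \<in> carrier R" "z = r \<otimes> a [^] Suc k" unfolding I_def by blast
    then have "z = (r \<otimes> a) \<otimes> a [^] k" using ac nat_pow_Suc2[OF ac, of k] by (metis m_assoc nat_pow_closed)
    then show "z \<in> I k" unfolding I_def using r ac by blast
  qed
  ultimately obtain N where "\<forall>n\<ge>N. I n = I N" using left_dcc by blast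
  then have "I (Suc N) = I N" using le_SucI[OF order_refl] by blast
  moreover have "a [^] N \<in> I N" unfolding I_def using ac by (intro image_eqI[of _ _ \<one>]) auto
  ultimately obtain r where r: "r \<in> carrier R" "a [^] N = r \<otimes> a [^] Suc N" unfolding I_def by blast
  have "a [^] N = (r \<otimes> a) \<otimes> a [^] N"
    using r ac nat_pow_Suc2[OF ac, of N] by (metis m_assoc nat_pow_closed)
  moreover have "(\<one> \<ominus> r \<otimes> a) \<otimes> a [^] N = a [^] N \<ominus> (r \<otimes> a) \<otimes> a [^] N"
    using r ac by (simp add: a_minus_def l_distr l_minus)
  ultimately have 0: "(\<one> \<ominus> r \<otimes> a) \<otimes> a [^] N = \<zero>" using ac by (simp add: a_minus_def r_neg)
  have "r \<otimes> a \<in> jacobson_radical R" using left_idealD(4)[OF jacobson_radical_left_ideal r(1) a] .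
  then obtain y where y: "y \<in> carrier R" "y \<otimes> (\<one> \<ominus> r \<otimes> a) = \<one>" using one_minus_radical_left_inverse by blast
  have "a [^] N = y \<otimes> (\<one> \<ominus> r \<otimes> a) \<otimes> a [^] N" using y ac by simp
  also have "\<dots> = \<zero>" using y(1) r ac 0 by (simp add: m_assoc)
  finally show ?thesis unfolding nilpotent_def using ac by blast
qed

text \<open>
  A descending chain in \<open>S\<close> is the image of its chain of preimages.
\<close>
lemma left_artinian_ring_image:
  assumes R: "left_artinian_ring R" and h: "ring_hom_ring R S h" and surj: "h ` carrier R = carrier S"
  shows "left_artinian_ring S"
proof -
  interpret R: left_artinian_ring R by fact
  interpret h: ring_hom_ring R S h by fact
  show ?thesis
  proof (intro left_artinian_ring.intro left_artinian_ring_axioms.intro h.S.ring_axioms)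
    fix I :: "nat \<Rightarrow> _ set"
    assume I: "\<And>n. left_ideal (I n) S" and dec: "\<And>n. I (Suc n) \<subseteq> I n"
    define K where "K n = {x \<in> carrier R. h x \<in> I n}" for n
    have "left_ideal (K n) R" for n
      using h.S.left_idealD[OF I[of n]] by (intro R.left_idealI) (auto simp: K_def)
    moreover have "K (Suc n) \<subseteq> K n" for n using dec by (auto simp: K_def)
    ultimately obtain N where N: "\<forall>n\<ge>N. K n = K N" using R.left_dcc by blast
    have "I n = h ` K n" for n
      using h.S.left_idealD(1)[OF I[of n]] surj by (auto simp: K_def)
    then show "\<exists>N. \<forall>n\<ge>N. I n = I N" using N by metis
  qed
qed

lemma carrier_Quot: "carrier (R Quot I) = a_r_coset R I ` carrier R"
  unfolding FactRing_def A_RCOSETS_def' by (simp add: UNION_singleton_eq_range)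

lemma (in ideal) coset_eq_zero_iff:
  assumes "x \<in> carrier R"
  shows "I +> x = \<zero>\<^bsub>R Quot I\<^esub> \<longleftrightarrow> x \<in> I"
proof -
  have "\<zero>\<^bsub>R Quot I\<^esub> = I" by (simp add: FactRing_def)
  then show ?thesis using rcos_const_imp_mem[OF assms] a_rcos_zero[OF ideal_axioms] by metis
qed

lemma (in left_artinian_ring) quotient_prime_left_artinian:
  assumes M: "maximalideal M R"
  shows "prime_left_artinian_ring (R Quot M)"
proof -
  interpret M: maximalideal M R by fact
  interpret h: ring_hom_ring R "R Quot M" "(+>) M" by (rule M.rcos_ring_hom_ring)
  have surj: "(+>) M ` carrier R = carrier (R Quot M)" by (rule carrier_Quot[symmetric])
  note ker = M.coset_eq_zero_iff
  show ?thesis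
  proof (intro prime_left_artinian_ring.intro prime_left_artinian_ring_axioms.intro)
    show "left_artinian_ring (R Quot M)"
      by (rule left_artinian_ring_image[OF left_artinian_ring_axioms M.rcos_ring_hom_ring surj])
    fix X Y assume XY: "X \<in> carrier (R Quot M)" "Y \<in> carrier (R Quot M)" 
      "X \<noteq> \<zero>\<^bsub>R Quot M\<^esub>" "Y \<noteq> \<zero>\<^bsub>R Quot M\<^esub>"
    then obtain x y where xy: "x \<in> carrier R" "X = M +> x" "y \<in> carrier R" "Y = M +> y"
      using surj by (metis imageE)
    then obtain s where s: "s \<in> carrier R" "x \<otimes> s \<otimes> y \<notin> M" 
      using maximal_ideal_prime[OF M] XY ker by metis
    have "X \<otimes>\<^bsub>R Quot M\<^esub> (M +> s) \<otimes>\<^bsub>R Quot M\<^esub> Y = M +> (x \<otimes> s \<otimes> y)" using xy s by simp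
    moreover have "M +> (x \<otimes> s \<otimes> y) \<noteq> \<zero>\<^bsub>R Quot M\<^esub>" using ker[of "x \<otimes> s \<otimes> y"] xy s by blast
    ultimately show "\<exists>S\<in>carrier (R Quot M). X \<otimes>\<^bsub>R Quot M\<^esub> S \<otimes>\<^bsub>R Quot M\<^esub> Y \<noteq> \<zero>\<^bsub>R Quot M\<^esub>"
      using h.hom_closed[OF s(1)] by metis
  qed
qed

text \<open>
  An element is a unit of \<open>R\<close> once its image modulo the radical is a unit, and nilpotent once its image is
  nilpotent. So the decomposition of \<open>J +> a\<close> lifts: take any preimage \<open>u\<close> of the unit and
  \<open>n = a \<ominus> u\<close>. Elements of the radical are nilpotent and use the summand zero.
\<close>
lemma (in left_artinian_ring) radical_maximal_imp_nil_good:
  assumes M: "maximalideal (jacobson_radical R) R"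
  shows "nil_good_ring R"
proof -
  define J where "J = jacobson_radical R"
  define Q where "Q = R Quot J"
  interpret J: maximalideal J R using M by (simp add: J_def)
  interpret Q: prime_left_artinian_ring Q
    unfolding Q_def by (rule quotient_prime_left_artinian[OF J.maximalideal_axioms])
  interpret h: ring_hom_ring R Q "(+>) J" unfolding Q_def by (rule J.rcos_ring_hom_ring)
  have surj: "\<exists>x\<in>carrier R. X = J +> x" if "X \<in> carrier Q" for X
    using that unfolding Q_def carrier_Quot by blast
  note ker = J.coset_eq_zero_iff[folded Q_def]
  have unit: "x \<in> Units R" if "x \<in> carrier R" "J +> x = \<one>\<^bsub>Q\<^esub>" for x
  proof -
    have "J +> (\<one> \<ominus> x) = \<zero>\<^bsub>Q\<^esub>" using that by (simp add: a_minus_def Q.r_neg)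
    then have "\<one> \<ominus> (\<one> \<ominus> x) \<in> Units R" 
      using that ker[of "\<one> \<ominus> x"] one_minus_radical_unit by (simp add: J_def)
    moreover have "\<one> \<ominus> (\<one> \<ominus> x) = x" using that(1) by algebra
    ultimately show ?thesis by simp
  qed
  have "nil_good R a" if a: "a \<in> carrier R" for a
  proof (cases "a \<in> J")
    case True
    then have "nilpotent R a" "a = a \<oplus> \<zero>" using jacobson_radical_nil a by (auto simp: J_def)
    then show ?thesis unfolding nil_good_def by blast
  next
    case False
    then have "nil_plus_unit Q \<one>\<^bsub>Q\<^esub> (J +> a)"
      using a ker h.hom_closed[OF a] by (intro Q.corner_nil_plus_unit) (auto simp: corner_def)
    then obtain N U V where NUV: "N \<in> carrier Q" "U \<in> carrier Q" "V \<in> carrier Q" "nilpotent Q N"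
      "U \<otimes>\<^bsub>Q\<^esub> V = \<one>\<^bsub>Q\<^esub>" "V \<otimes>\<^bsub>Q\<^esub> U = \<one>\<^bsub>Q\<^esub>" "J +> a = N \<oplus>\<^bsub>Q\<^esub> U"
      unfolding nil_plus_unit_def corner_def by blast
    obtain u v where uv: "u \<in> carrier R" "U = J +> u" "v \<in> carrier R" "V = J +> v"
      using NUV(2,3) surj by metis
    have "u \<otimes> v \<in> Units R" "v \<otimes> u \<in> Units R" using unit NUV uv by simp_all
    then have "u \<otimes> (v \<otimes> inv (u \<otimes> v)) = \<one>" "(inv (v \<otimes> u) \<otimes> v) \<otimes> u = \<one>"
      and c: "inv (u \<otimes> v) \<in> carrier R" "inv (v \<otimes> u) \<in> carrier R"
      using uv by (simp_all add: m_assoc[symmetric]) (simp_all add: m_assoc)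
    then have u: "u \<in> Units R" using uv by (intro two_sided_inverse_unit[of u "inv (v \<otimes> u) \<otimes> v" "v \<otimes> inv (u \<otimes> v)"]) auto
    define n where "n = a \<ominus> u"
    have n: "n \<in> carrier R" using a uv by (simp add: n_def)
    have "J +> n = (N \<oplus>\<^bsub>Q\<^esub> U) \<ominus>\<^bsub>Q\<^esub> U" using a uv NUV by (simp add: n_def a_minus_def)
    also have "\<dots> = N" using NUV(1,2) by (simp add: a_minus_def Q.a_assoc Q.r_neg)
    finally have hn: "J +> n = N" .
    have pow: "J +> (n [^] k) = N [^]\<^bsub>Q\<^esub> k" for k :: nat
      by (induction k) (use n hn in auto)
    obtain k where "N [^]\<^bsub>Q\<^esub> (k::nat) = \<zero>\<^bsub>Q\<^esub>" using NUV(4) unfolding nilpotent_def by blast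
    then have "n [^] k \<in> J" using pow ker n by (metis nat_pow_closed)
    then obtain l where "(n [^] k) [^] (l::nat) = \<zero>"
      using jacobson_radical_nil unfolding J_def nilpotent_def by blast
    then have "nilpotent R n" using n unfolding nilpotent_def by (auto simp: nat_pow_pow)
    moreover have "a = n \<oplus> u" unfolding n_def using a uv(1) by algebra
    ultimately show ?thesis unfolding nil_good_def using u by blast
  qed
  then show ?thesis unfolding nil_good_ring_def using ring_axioms by blast
qed

section \<open>Nil-good left artinian rings\<close>

theorem proposition4p5:
  fixes R (structure)
  assumes "left_artinian_ring R"
    and "carrier R \<noteq> {\<zero>}"
  shows "nil_good_ring R \<longleftrightarrow> maximalideal (jacobson_radical R) R"
proof -
  interpret left_artinian_ring R by fact
  have "\<one> \<noteq> \<zero>" using assms(2) carrier_one_not_zero by blast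
  then show ?thesis using nil_good_imp_radical_maximal radical_maximal_imp_nil_good by blast
qed

end
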